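(* Let $G$ be a bipartite graph on $n$ vertices with parts $X$ and $Y$ and $\delta(G)\ge 1$, let $k=\operatorname{rank}_{\mathbb{F}_2}(M)$, where $M\in\mathbb{F}_2^{X\times Y}$ is the bipartite adjacency matrix of $G$, and let $m:=\max\{|X|,|Y|\}$, so that $m\ge n/2$. If $k\le \frac{2m}{3}$, then $$f_o(G)\ \ge\ \frac m2+\frac{k^2}{8(m-k)}.$$
   Context: All graphs are finite and simple (no loops, no multiple edges) with nonempty vertex set. The bipartite adjacency matrix $M$ has rows indexed by $X$, columns indexed by $Y$, and $(x,y)$ entry $1$ if $xy\in E(G)$ and $0$ otherwise; its rank is taken over $\mathbb{F}_2$. $f_o(G)$ denotes the maximum size of a set $S\subseteq V(G)$ such that every vertex of the induced subgraph $G[S]$ has odd degree in $G[S]$. *)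

theory Defs
  imports Complex_Main "HOL-Library.Function_Algebras" "HOL-Library.Z2"
begin

definition simple_graph :: "'a set \<Rightarrow> 'a set set \<Rightarrow> bool" where
  "simple_graph V E \<longleftrightarrow> finite V \<and> V \<noteq> {} \<and> (\<forall>e\<in>E. e \<subseteq> V \<and> card e = 2)"

definition bipartite_parts :: "'a set \<Rightarrow> 'a set set \<Rightarrow> 'a set \<Rightarrow> 'a set \<Rightarrow> bool" where
  "bipartite_parts V E X Y \<longleftrightarrow>
     X \<union> Y = V \<and> X \<inter> Y = {} \<and> (\<forall>e\<in>E. \<exists>x\<in>X. \<exists>y\<in>Y. e = {x, y})"

definition vdegree :: "'a set set \<Rightarrow> 'a \<Rightarrow> nat" where
  "vdegree E v = card {e \<in> E. v \<in> e}"

definition min_vdegree :: "'a set \<Rightarrow> 'a set set \<Rightarrow> nat" where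
  "min_vdegree V E = Min (vdegree E ` V)"

definition induced_edges :: "'a set set \<Rightarrow> 'a set \<Rightarrow> 'a set set" where
  "induced_edges E S = {e \<in> E. e \<subseteq> S}"

text \<open>The empty set is admissible below, so the maximum is over a nonempty set.\<close>

definition f_odd :: "'a set \<Rightarrow> 'a set set \<Rightarrow> nat" where
  "f_odd V E =
     Max (card ` {S. S \<subseteq> V \<and> (\<forall>v\<in>S. odd (vdegree (induced_edges E S) v))})"

definition fun_scale :: "'f::field \<Rightarrow> ('c \<Rightarrow> 'f) \<Rightarrow> 'c \<Rightarrow> 'f" where
  "fun_scale a v = (\<lambda>j. a * v j)"

text \<open>
  The matrices considered have rows indexed by a set \<open>R\<close> and columns indexed by a set \<open>C\<close>;
  the entries of \<open>M\<close> outside \<open>R \<times> C\<close> play no role. A row is a vector in \<open>F\<^sup>C\<close>, represented as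
  a function vanishing outside \<open>C\<close>, and the rank is the dimension of the span of the rows.
\<close>

definition matrix_row :: "'c set \<Rightarrow> ('r \<Rightarrow> 'c \<Rightarrow> 'f::field) \<Rightarrow> 'r \<Rightarrow> 'c \<Rightarrow> 'f" where
  "matrix_row C M i = (\<lambda>j. if j \<in> C then M i j else 0)"

definition matrix_rank :: "'r set \<Rightarrow> 'c set \<Rightarrow> ('r \<Rightarrow> 'c \<Rightarrow> 'f::field) \<Rightarrow> nat" where
  "matrix_rank R C M = vector_space.dim fun_scale (matrix_row C M ` R)"

lemma vector_space_fun_scale:
  "vector_space (fun_scale :: 'f::field \<Rightarrow> ('c \<Rightarrow> 'f) \<Rightarrow> 'c \<Rightarrow> 'f)"
  by unfold_locales (auto simp: fun_scale_def plus_fun_def fun_eq_iff algebra_simps)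

text \<open>The type \<^typ>\<open>bit\<close> is the two-element field.\<close>

definition bip_adj :: "'a set set \<Rightarrow> 'a \<Rightarrow> 'a \<Rightarrow> bit" where
  "bip_adj E x y = (if {x, y} \<in> E then 1 else 0)"

end

theory Submission imports Defs begin

text \<open>
  Let \<open>P\<close> be the larger side and \<open>Q\<close> the other one. If \<open>T \<subseteq> P\<close> is the support of a vector in the
  span of the neighbourhood vectors of \<open>Q\<close>, then \<open>f_o \<ge> |T|\<close>: take \<open>S \<subseteq> Q\<close> of minimal size such that
  every vertex of \<open>T\<close> has an odd number of neighbours in \<open>S\<close>. By minimality the rows of \<open>S\<close> are
  independent on \<open>T\<close>, so deleting at most \<open>|S|\<close> vertices of \<open>T\<close> makes all degrees of \<open>S\<close> odd.

  A vector of large weight is found by choosing its values on \<open>k\<close> pivot coordinates in \<open>P\<close>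
  independently, each being 1 with probability \<open>1/2 + t\<close>. A pivot coordinate is then 1 with
  probability \<open>1/2 + t\<close>, any other one with probability at least \<open>1/2 - 2t\<^sup>2\<close>, so the expected weight
  is at least \<open>m/2 + k t - 2 (m - k) t\<^sup>2\<close>. Choose \<open>t = k / (4 (m - k))\<close>.
\<close>

section \<open>Pivot rows and linear systems\<close>

lemma sum_fun_apply: "(\<Sum>x\<in>A. f x) j = (\<Sum>x\<in>A. f x j)"
  for f :: "'b \<Rightarrow> 'c \<Rightarrow> 'd::comm_monoid_add"
  by (induction A rule: infinite_finite_induct) auto

text \<open>A basis of the row space is chosen among the rows and restated with explicit
  coefficients, so that later arguments need no spans.\<close>

lemma pivot_rows:
  fixes M :: "'r \<Rightarrow> 'c \<Rightarrow> 'f::field"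
  assumes "finite R"
  obtains B where "B \<subseteq> R" "card B = matrix_rank R C M"
    "\<forall>d. (\<forall>j\<in>C. (\<Sum>b\<in>B. d b * M b j) = 0) \<longrightarrow> (\<forall>b\<in>B. d b = 0)"
    "\<forall>i\<in>R. \<exists>a. \<forall>j\<in>C. M i j = (\<Sum>b\<in>B. a b * M b j)"
proof -
  interpret vs: vector_space "fun_scale :: 'f \<Rightarrow> ('c \<Rightarrow> 'f) \<Rightarrow> 'c \<Rightarrow> 'f"
    by (rule vector_space_fun_scale)
  let ?r = "matrix_row C M"
  obtain W where W: "W \<subseteq> ?r ` R" "vs.independent W" "?r ` R \<subseteq> vs.span W"
    "card W = vs.dim (?r ` R)"
    by (rule vs.basis_exists)
  \<comment> \<open>Different indices may carry the same row, so one index is picked for each basis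
    vector; coefficients can then be moved between \<open>W\<close> and \<open>B\<close>.\<close>
  obtain B where B: "B \<subseteq> R" "inj_on ?r B" "W = ?r ` B"
    using W(1) unfolding subset_image_inj by blast
  have fin: "finite B" "finite W"
    using B assms finite_subset by auto
  have comb: "(\<Sum>v\<in>W. fun_scale (u v) v) j = (if j \<in> C then \<Sum>b\<in>B. u (?r b) * M b j else 0)" for u j
    unfolding B(3) sum.reindex[OF B(2)] by (simp add: sum_fun_apply fun_scale_def matrix_row_def)
  show thesis
  proof
    show "B \<subseteq> R" by (rule B)
    show "card B = matrix_rank R C M"
      using W(4) B by (simp add: matrix_rank_def card_image)
    show "\<forall>d. (\<forall>j\<in>C. (\<Sum>b\<in>B. d b * M b j) = 0) \<longrightarrow> (\<forall>b\<in>B. d b = 0)"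
    proof (intro allI impI)
      fix d assume d: "\<forall>j\<in>C. (\<Sum>b\<in>B. d b * M b j) = 0"
      define u where "u v = d (inv_into B ?r v)" for v
      have u: "u (?r b) = d b" if "b \<in> B" for b
        using that B(2) by (simp add: u_def)
      have "(\<Sum>v\<in>W. fun_scale (u v) v) = 0"
      proof
        fix j show "(\<Sum>v\<in>W. fun_scale (u v) v) j = 0 j"
          unfolding comb using d by (auto simp: u cong: sum.cong)
      qed
      then have "\<forall>v\<in>W. u v = 0"
        using W(2) vs.dependent_finite[OF fin(2)] by blast
      then show "\<forall>b\<in>B. d b = 0" using u B(3) by auto
    qed
    show "\<forall>i\<in>R. \<exists>a. \<forall>j\<in>C. M i j = (\<Sum>b\<in>B. a b * M b j)"
    proof
      fix i assume "i \<in> R"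
      then have "?r i \<in> vs.span W" using W(3) by blast
      then obtain u where "?r i = (\<Sum>v\<in>W. fun_scale (u v) v)"
        unfolding vs.span_finite[OF fin(2)] by blast
      then have "?r i j = (if j \<in> C then \<Sum>b\<in>B. u (?r b) * M b j else 0)" for j
        by (simp only: comb)
      then have "\<forall>j\<in>C. M i j = (\<Sum>b\<in>B. u (?r b) * M b j)"
        by (metis matrix_row_def)
      then show "\<exists>a. \<forall>j\<in>C. M i j = (\<Sum>b\<in>B. a b * M b j)"
        by (intro exI[of _ "\<lambda>b. u (?r b)"])
    qed
  qed
qed

text \<open>Writing all rows through the pivot rows factors \<open>M\<close> through
  \<open>card B\<close> dimensions: every column is a combination of the \<open>card B\<close>
  columns of the coefficient matrix.\<close>

lemma matrix_rank_transpose_le: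
  fixes M :: "'r \<Rightarrow> 'c \<Rightarrow> 'f::field"
  assumes "finite R"
  shows "matrix_rank C R (\<lambda>j i. M i j) \<le> matrix_rank R C M"
proof -
  interpret vs: vector_space "fun_scale :: 'f \<Rightarrow> ('r \<Rightarrow> 'f) \<Rightarrow> 'r \<Rightarrow> 'f"
    by (rule vector_space_fun_scale)
  obtain B where B: "B \<subseteq> R" "card B = matrix_rank R C M"
    "\<forall>i\<in>R. \<exists>a. \<forall>j\<in>C. M i j = (\<Sum>b\<in>B. a b * M b j)"
    by (rule pivot_rows[OF assms])
  have finB: "finite B" using B(1) assms finite_subset by blast
  obtain a where a: "\<And>i j. i \<in> R \<Longrightarrow> j \<in> C \<Longrightarrow> M i j = (\<Sum>b\<in>B. a i b * M b j)"
    using B(3) by metis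
  \<comment> \<open>Column \<open>b\<close> of the coefficient matrix, set to 0 outside
    \<open>R\<close> to match the vectors given by \<open>matrix_row\<close>.\<close>
  define w where "w b = (\<lambda>i. if i \<in> R then a i b else 0)" for b
  have "matrix_row R (\<lambda>j i. M i j) j \<in> vs.span (w ` B)" if "j \<in> C" for j
  proof -
    have "matrix_row R (\<lambda>j i. M i j) j = (\<Sum>b\<in>B. fun_scale (M b j) (w b))"
      by (rule ext) (auto simp: sum_fun_apply fun_scale_def w_def matrix_row_def a[OF _ that]
          mult.commute intro: sum.cong)
    then show ?thesis
      by (simp add: vs.span_sum vs.span_scale vs.span_base)
  qed
  then have "vs.dim (matrix_row R (\<lambda>j i. M i j) ` C) \<le> card (w ` B)"
    by (intro vs.dim_le_card) (auto simp: finB)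
  also have "\<dots> \<le> card B" by (rule card_image_le[OF finB])
  finally show ?thesis by (simp add: matrix_rank_def B(2)[unfolded matrix_rank_def])
qed

lemma matrix_rank_transpose:
  assumes "finite R" "finite C"
  shows "matrix_rank C R (\<lambda>j i. M i j) = matrix_rank R C M"
  using matrix_rank_transpose_le[OF assms(1), of C M]
    matrix_rank_transpose_le[OF assms(2), of R "\<lambda>j i. M i j"]
  by simp

text \<open>Gaussian elimination: independent columns allow any right-hand side \<open>u\<close>.
  The bound on the support \<open>S\<close> of the solution is needed later to limit the number of
  deleted vertices.\<close>

lemma independent_system_solvable:
  fixes M :: "'x \<Rightarrow> 'c \<Rightarrow> 'f::field"
  assumes "finite C" "finite X"
    and "\<And>d. \<forall>x\<in>X. (\<Sum>c\<in>C. d c * M x c) = 0 \<Longrightarrow> \<forall>c\<in>C. d c = 0"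
  shows "\<exists>S a. S \<subseteq> X \<and> card S \<le> card C \<and> (\<forall>c\<in>C. (\<Sum>x\<in>S. a x * M x c) = u c)"
  using assms
proof (induction C arbitrary: M u rule: finite_induct)
  case empty
  then show ?case by (intro exI[of _ "{}"]) auto
next
  case (insert c0 C)
  obtain x0 where x0: "x0 \<in> X" "M x0 c0 \<noteq> 0"
  proof (rule ccontr)
    assume neg: "\<not> thesis"
    \<comment> \<open>If column \<open>c0\<close> vanished on \<open>X\<close>, the indicator of
      \<open>c0\<close> would be a nontrivial relation.\<close>
    have "(\<Sum>c\<in>insert c0 C. of_bool (c = c0) * M x c) = M x c0" for x
      using insert.hyps by (subst sum.remove[of _ c0]) (auto intro: sum.neutral)
    then have "\<forall>c\<in>insert c0 C. (of_bool (c = c0) :: 'f) = 0"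
      using neg that by (intro insert.prems(2)) auto
    then show False by simp
  qed
  define r where "r c = M x0 c / M x0 c0" for c
  \<comment> \<open>Subtracting multiples of column \<open>c0\<close> clears row
    \<open>x0\<close>.\<close>
  define M' where "M' x c = M x c - r c * M x c0" for x c
  have "\<forall>c\<in>C. d c = 0" if d: "\<forall>x\<in>X. (\<Sum>c\<in>C. d c * M' x c) = 0" for d
  proof -
    \<comment> \<open>A relation among the reduced columns lifts to the original ones: the
      coefficient at \<open>c0\<close> collects the subtracted multiples.\<close>
    define d' where "d' c = (if c = c0 then - (\<Sum>c\<in>C. d c * r c) else d c)" for c
    have "(\<Sum>c\<in>insert c0 C. d' c * M x c) = (\<Sum>c\<in>C. d c * M' x c)" for x
    proof -
      have "(\<Sum>c\<in>C. d' c * M x c) = (\<Sum>c\<in>C. d c * M x c)"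
        using insert.hyps by (intro sum.cong) (auto simp: d'_def)
      then show ?thesis
        using insert.hyps
        by (simp add: d'_def M'_def algebra_simps sum_subtractf sum_distrib_left sum_distrib_right)
    qed
    then have "\<forall>c\<in>insert c0 C. d' c = 0"
      using d by (intro insert.prems(2)) simp
    then show ?thesis using insert.hyps by (auto simp: d'_def split: if_splits)
  qed
  then obtain S a where S: "S \<subseteq> X" "card S \<le> card C"
    "\<And>c. c \<in> C \<Longrightarrow> (\<Sum>x\<in>S. a x * M' x c) = u c - r c * u c0"
    using insert.IH[of M' "\<lambda>c. u c - r c * u c0"] insert.prems(1) by blast
  have finS: "finite S" using S(1) insert.prems(1) finite_subset by blast
  \<comment> \<open>The extra multiple of row \<open>x0\<close> that makes the equation at
    \<open>c0\<close> exact; the reduced equations are unaffected, as row \<open>x0\<close> of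
    \<open>M'\<close> is zero.\<close>
  define e where "e = (u c0 - (\<Sum>x\<in>S. a x * M x c0)) / M x0 c0"
  \<comment> \<open>The correction is added, since \<open>x0\<close> may already lie in
    \<open>S\<close>.\<close>
  define b where "b x = (if x \<in> S then a x else 0) + (if x = x0 then e else 0)" for x
  have sum_b: "(\<Sum>x\<in>insert x0 S. b x * M x c) = (\<Sum>x\<in>S. a x * M x c) + e * M x0 c" for c
  proof -
    have "(\<Sum>x\<in>insert x0 S. b x * M x c)
        = (\<Sum>x\<in>insert x0 S. (if x \<in> S then a x * M x c else 0))
          + (\<Sum>x\<in>insert x0 S. (if x = x0 then e * M x0 c else 0))"
      unfolding sum.distrib[symmetric] by (intro sum.cong) (auto simp: b_def algebra_simps)
    also have "(\<Sum>x\<in>insert x0 S. (if x \<in> S then a x * M x c else 0)) = (\<Sum>x\<in>S. a x * M x c)"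
      using finS by (intro sum.mono_neutral_cong_right) auto
    finally show ?thesis using finS by simp
  qed
  have "(\<Sum>x\<in>insert x0 S. b x * M x c) = u c" if "c \<in> insert c0 C" for c
  proof (cases "c = c0")
    case True
    then show ?thesis unfolding sum_b using x0 by (simp add: e_def)
  next
    case False
    then have "(\<Sum>x\<in>S. a x * M x c) = u c - r c * u c0 + r c * (\<Sum>x\<in>S. a x * M x c0)"
      using S(3)[of c] that
      by (simp add: M'_def algebra_simps sum_subtractf sum_distrib_left)
    moreover have "e * M x0 c = r c * (u c0 - (\<Sum>x\<in>S. a x * M x c0))"
      by (simp add: e_def r_def)
    ultimately show ?thesis unfolding sum_b by (simp only: right_diff_distrib) simp
  qed
  moreover have "card (insert x0 S) \<le> card (insert c0 C)"
    using S(2) finS insert.hyps by (simp add: card_insert_if)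
  ultimately show ?case
    using S(1) x0(1) by (intro exI[of _ "insert x0 S"] exI[of _ b]) auto
qed

section \<open>Linear algebra over the two-element field\<close>

lemma sum_bit_mult:
  fixes a f :: "'c \<Rightarrow> bit"
  assumes "finite C"
  shows "(\<Sum>c\<in>C. a c * f c) = (\<Sum>c\<in>{c\<in>C. a c = 1}. f c)"
  using assms by (intro sum.mono_neutral_cong_right) auto

lemma sum_bit_eq_1_iff:
  fixes f :: "'c \<Rightarrow> bit"
  assumes "finite C"
  shows "(\<Sum>c\<in>C. f c) = 1 \<longleftrightarrow> odd (card {c\<in>C. f c = 1})"
proof -
  have "(\<Sum>c\<in>C. f c) = (\<Sum>c\<in>{c\<in>C. f c = 1}. 1)"
    using assms by (intro sum.mono_neutral_cong_right) auto
  moreover have "of_nat n = (1::bit) \<longleftrightarrow> odd n" for n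
    by (induction n) auto
  ultimately show ?thesis by simp
qed

text \<open>Coefficient vectors over \<open>bit\<close> are indicators of sets, so relations and
  solutions both become subset sums.\<close>

lemma independent_system_solvable_bit:
  fixes A :: "'x \<Rightarrow> 'c \<Rightarrow> bit"
  assumes "finite C" "finite X"
    and indep: "\<And>D. D \<subseteq> C \<Longrightarrow> D \<noteq> {} \<Longrightarrow> \<exists>x\<in>X. (\<Sum>c\<in>D. A x c) = 1"
  shows "\<exists>S. S \<subseteq> X \<and> card S \<le> card C \<and> (\<forall>c\<in>C. (\<Sum>x\<in>S. A x c) = u c)"
proof -
  have "\<forall>c\<in>C. d c = 0" if "\<forall>x\<in>X. (\<Sum>c\<in>C. d c * A x c) = 0" for d
  proof (rule ccontr)
    assume "\<not> ?thesis"
    then have "{c\<in>C. d c = 1} \<noteq> {}" by auto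
    then obtain x where "x \<in> X" "(\<Sum>c\<in>C. d c * A x c) = 1"
      unfolding sum_bit_mult[OF assms(1)] using indep[of "{c\<in>C. d c = 1}"] by auto
    then show False using that by (metis zero_neq_one)
  qed
  then obtain S a where S: "S \<subseteq> X" "card S \<le> card C"
    "\<And>c. c \<in> C \<Longrightarrow> (\<Sum>x\<in>S. a x * A x c) = u c"
    using independent_system_solvable[OF assms(1,2), of A u] by blast
  have finS: "finite S" using S(1) assms(2) finite_subset by blast
  show ?thesis
  proof (intro exI conjI ballI)
    show "{x\<in>S. a x = 1} \<subseteq> X" using S(1) by auto
    show "card {x\<in>S. a x = 1} \<le> card C"
      using S(2) card_mono[OF finS, of "{x\<in>S. a x = 1}"] by auto
    show "(\<Sum>x\<in>{x\<in>S. a x = 1}. A x c) = u c" if "c \<in> C" for c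
      using S(3)[OF that] unfolding sum_bit_mult[OF finS] .
  qed
qed

section \<open>Vectors of large weight\<close>

lemma sum_Pow_sign:
  fixes p :: real
  assumes "finite C" "D \<subseteq> C"
  shows "(\<Sum>U\<in>Pow C. p ^ card U * (1 - p) ^ card (C - U) * (-1) ^ card (U \<inter> D)) = (1 - 2 * p) ^ card D"
proof -
  let ?f = "\<lambda>c. p * (if c \<in> D then -1 else 1)"
  have "(\<Prod>c\<in>C. ?f c + (1 - p)) = (\<Sum>U\<in>Pow C. prod ?f U * (\<Prod>c\<in>C - U. 1 - p))"
    by (rule prod_add[OF assms(1)])
  also have "\<dots> = (\<Sum>U\<in>Pow C. p ^ card U * (1 - p) ^ card (C - U) * (-1) ^ card (U \<inter> D))"
  proof (rule sum.cong[OF refl])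
    fix U assume "U \<in> Pow C"
    then have "finite U" using assms(1) finite_subset by blast
    then have "(\<Prod>c\<in>U. if c \<in> D then -1 else 1::real) = (-1) ^ card (U \<inter> D)"
      by (simp add: prod.If_cases Int_def)
    then show "prod ?f U * (\<Prod>c\<in>C - U. 1 - p)
        = p ^ card U * (1 - p) ^ card (C - U) * (-1) ^ card (U \<inter> D)"
      by (simp add: prod.distrib)
  qed
  also have "(\<Prod>c\<in>C. ?f c + (1 - p)) = (\<Prod>c\<in>D. 1 - 2 * p)"
    using assms by (intro prod.mono_neutral_cong_right) auto
  finally show ?thesis by simp
qed

text \<open>First-moment argument: \<open>w\<close> is the distribution of a random
  \<open>U\<close>, and \<open>x\<close> is counted with probability
  \<open>(1 - (- 2 * t) ^ card (D x)) / 2\<close>. Some \<open>U\<close> does at least as well as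
  the average.\<close>

lemma exists_subset_many_odd:
  fixes t :: real and D :: "'p \<Rightarrow> 'p set"
  assumes "finite P" "C \<subseteq> P"
    and D: "\<And>x. x \<in> P \<Longrightarrow> D x \<subseteq> C" "\<And>x. x \<in> P \<Longrightarrow> D x \<noteq> {}" "\<And>c. c \<in> C \<Longrightarrow> D c = {c}"
    and t: "0 \<le> t" "t \<le> 1/2"
  shows "\<exists>U\<subseteq>C. real (card {x\<in>P. odd (card (U \<inter> D x))})
    \<ge> card P / 2 + card C * t - 2 * (real (card P) - card C) * t\<^sup>2"
proof -
  have finC: "finite C" using assms finite_subset by blast
  define w where "w U = (1/2 + t) ^ card U * (1 - (1/2 + t)) ^ card (C - U)" for U :: "'p set"
  define N where "N U = real (card {x\<in>P. odd (card (U \<inter> D x))})" for U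
  have w0: "w U \<ge> 0" for U using t by (simp add: w_def)
  have sign: "(\<Sum>U\<in>Pow C. w U * (-1) ^ card (U \<inter> B)) = (- 2 * t) ^ card B" if "B \<subseteq> C" for B
    using sum_Pow_sign[OF finC that, of "1/2 + t"] by (simp add: w_def algebra_simps)
  have w1: "(\<Sum>U\<in>Pow C. w U) = 1" using sign[of "{}"] by simp
  have N: "N U = (\<Sum>x\<in>P. (1 - (-1) ^ card (U \<inter> D x)) / 2)" for U
  proof -
    have "(\<Sum>x\<in>P. (1 - (-1) ^ card (U \<inter> D x)) / 2) = (\<Sum>x\<in>{x\<in>P. odd (card (U \<inter> D x))}. 1::real)"
      using assms(1) by (intro sum.mono_neutral_cong_right) auto
    then show ?thesis by (simp add: N_def)
  qed
  have "(\<Sum>U\<in>Pow C. w U * N U) = (\<Sum>x\<in>P. \<Sum>U\<in>Pow C. w U * ((1 - (-1) ^ card (U \<inter> D x)) / 2))"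
    unfolding N sum_distrib_left by (rule sum.swap)
  also have "\<dots> = (\<Sum>x\<in>P. (1 - (- 2 * t) ^ card (D x)) / 2)"
  proof (rule sum.cong[OF refl])
    fix x assume "x \<in> P"
    have "(\<Sum>U\<in>Pow C. w U * ((1 - (-1) ^ card (U \<inter> D x)) / 2))
      = ((\<Sum>U\<in>Pow C. w U) - (\<Sum>U\<in>Pow C. w U * (-1) ^ card (U \<inter> D x))) / 2"
      unfolding sum_subtractf[symmetric] sum_divide_distrib by (simp add: algebra_simps)
    then show "(\<Sum>U\<in>Pow C. w U * ((1 - (-1) ^ card (U \<inter> D x)) / 2)) = (1 - (- 2 * t) ^ card (D x)) / 2"
      using sign[OF D(1)[OF \<open>x \<in> P\<close>]] w1 by simp
  qed
  also have "\<dots> \<ge> (\<Sum>x\<in>P. if x \<in> C then 1/2 + t else 1/2 - 2 * t\<^sup>2)"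
  proof (rule sum_mono)
    fix x assume x: "x \<in> P"
    show "(if x \<in> C then 1/2 + t else 1/2 - 2 * t\<^sup>2) \<le> (1 - (- 2 * t) ^ card (D x)) / 2"
    proof (cases "x \<in> C")
      case True
      then show ?thesis using D(3) by simp
    next
      case False
      have "finite (D x)" using D(1)[OF x] finC finite_subset by blast
      then have "card (D x) \<noteq> 0" using D(2)[OF x] by simp
      \<comment> \<open>A singleton gives a nonpositive power; from size 2 on,
        \<open>2 * t \<le> 1\<close> bounds the power by the square.\<close>
      then consider "card (D x) = 1" | "card (D x) \<ge> 2" by linarith
      then have "(- 2 * t) ^ card (D x) \<le> (2 * t)\<^sup>2"
      proof cases
        case 1
        then have "(- 2 * t) ^ card (D x) \<le> 0" using t by simp
        then show ?thesis by (rule order_trans) simp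
      next
        case 2
        have "(- 2 * t) ^ card (D x) \<le> \<bar>(- 2 * t) ^ card (D x)\<bar>" by (rule abs_ge_self)
        also have "\<dots> = (2 * t) ^ card (D x)" using t by (simp add: power_abs abs_mult)
        also have "\<dots> \<le> (2 * t)\<^sup>2" using t 2 by (intro power_decreasing) auto
        finally show ?thesis .
      qed
      then show ?thesis using False by (simp add: power_mult_distrib)
    qed
  qed
  also have "(\<Sum>x\<in>P. if x \<in> C then 1/2 + t else 1/2 - 2 * t\<^sup>2)
      = card C * (1/2 + t) + real (card (P - C)) * (1/2 - 2 * t\<^sup>2)"
    using assms(1,2) by (simp add: sum.If_cases Int_absorb1 Diff_eq)
  also have "\<dots> = card P / 2 + card C * t - 2 * (real (card P) - card C) * t\<^sup>2"
    using assms(1,2) finC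
    by (simp add: card_Diff_subset of_nat_diff card_mono algebra_simps)
  finally have ge: "card P / 2 + card C * t - 2 * (real (card P) - card C) * t\<^sup>2
      \<le> (\<Sum>U\<in>Pow C. w U * N U)" (is "?b \<le> _") .
  show ?thesis
  proof (rule ccontr)
    assume "\<not> ?thesis"
    then have less: "N U < ?b" if "U \<in> Pow C" for U
      using that by (force simp: N_def not_le)
    \<comment> \<open>Weights can be 0 when \<open>t = 1/2\<close>, so strictness is not summed
      termwise; the maximum stays strictly below the bound.\<close>
    define s where "s = Max (N ` Pow C)"
    have "N ` Pow C \<noteq> {}" "finite (N ` Pow C)" using finC by auto
    then have s: "s < ?b" "\<And>U. U \<in> Pow C \<Longrightarrow> N U \<le> s"
      unfolding s_def using less by (auto simp: Max_less_iff)
    have "(\<Sum>U\<in>Pow C. w U * N U) \<le> (\<Sum>U\<in>Pow C. w U * s)"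
      using s(2) w0 by (intro sum_mono mult_left_mono)
    also have "\<dots> = s" by (simp add: sum_distrib_right[symmetric] w1)
    finally show False using ge s(1) by linarith
  qed
qed

section \<open>Odd induced subgraphs\<close>

text \<open>Deleting a set \<open>U\<close> from \<open>T0\<close> repairs the parities in a minimal
  \<open>S\<close>. It costs at most \<open>card S\<close> elements, which \<open>S\<close> itself
  pays back, and the condition on the columns in \<open>T0\<close> survives the deletion.\<close>

lemma odd_pair_of_row_combination:
  fixes A :: "'q \<Rightarrow> 'p \<Rightarrow> bit"
  assumes "finite Q" "T0 \<subseteq> P" "finite P" "S0 \<subseteq> Q" "\<forall>x\<in>T0. (\<Sum>q\<in>S0. A q x) = 1"
  shows "\<exists>S T. S \<subseteq> Q \<and> T \<subseteq> P \<and> card T0 \<le> card S + card T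
    \<and> (\<forall>s\<in>S. (\<Sum>x\<in>T. A s x) = 1) \<and> (\<forall>x\<in>T. (\<Sum>s\<in>S. A s x) = 1)"
proof -
  define good where "good S \<longleftrightarrow> S \<subseteq> Q \<and> (\<forall>x\<in>T0. (\<Sum>q\<in>S. A q x) = 1)" for S
  have "good S0" using assms by (simp add: good_def)
  then obtain S where S: "good S" "\<And>S'. good S' \<Longrightarrow> card S \<le> card S'"
    using ex_has_least_nat[of good S0 card] by auto
  have fin: "finite S" "finite T0"
    using S(1) assms finite_subset unfolding good_def by blast+
  have "\<exists>x\<in>T0. (\<Sum>s\<in>D. A s x) = 1" if D: "D \<subseteq> S" "D \<noteq> {}" for D
  proof (rule ccontr)
    assume "\<not> ?thesis"
    then have "\<forall>x\<in>T0. (\<Sum>s\<in>D. A s x) = 0" by simp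
    \<comment> \<open>Rows summing to zero on \<open>T0\<close> could be dropped from
      \<open>S\<close>, against minimality.\<close>
    then have "good (S - D)"
      using S(1) D fin by (auto simp: good_def sum_diff[OF fin(1) D(1)])
    moreover have "card (S - D) < card S"
      using D fin by (intro psubset_card_mono) auto
    ultimately show False using S(2) by (meson not_le)
  qed
  \<comment> \<open>The right-hand side is the parity to be removed from row \<open>s\<close> so
    that the rest of \<open>T0\<close> contributes 1.\<close>
  then have "\<exists>U. U \<subseteq> T0 \<and> card U \<le> card S
      \<and> (\<forall>s\<in>S. (\<Sum>x\<in>U. A s x) = 1 + (\<Sum>x\<in>T0. A s x))"
    by (rule independent_system_solvable_bit[OF fin])
  then obtain U where U: "U \<subseteq> T0" "card U \<le> card S"
    "\<forall>s\<in>S. (\<Sum>x\<in>U. A s x) = 1 + (\<Sum>x\<in>T0. A s x)"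
    by (elim exE conjE)
  show ?thesis
  proof (intro exI conjI ballI)
    show "S \<subseteq> Q" using S(1) by (simp add: good_def)
    show "T0 - U \<subseteq> P" using assms(2) by auto
    show "card T0 \<le> card S + card (T0 - U)"
      using U(1,2) fin card_Diff_subset[of U T0] finite_subset[of U T0] by simp
    show "(\<Sum>x\<in>T0 - U. A s x) = 1" if "s \<in> S" for s
    proof -
      have "b = 1" if "a = b + (1 + a)" for a b :: bit
        using that by (cases a; cases b) auto
      moreover have "(\<Sum>x\<in>T0. A s x) = (\<Sum>x\<in>T0 - U. A s x) + (1 + (\<Sum>x\<in>T0. A s x))"
        using sum.subset_diff[OF U(1) fin(2), of "A s"] U(3) that by simp
      ultimately show ?thesis by blast
    qed
    show "(\<Sum>s\<in>S. A s x) = 1" if "x \<in> T0 - U" for x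
      using that S(1) by (auto simp: good_def)
  qed
qed

section \<open>Degrees in induced subgraphs of a bipartite graph\<close>

lemma bip_adj_commute: "bip_adj E x y = bip_adj E y x"
  by (simp add: bip_adj_def insert_commute)

lemma bipartite_parts_commute: "bipartite_parts V E X Y \<longleftrightarrow> bipartite_parts V E Y X"
proof -
  have "(\<exists>x\<in>X. \<exists>y\<in>Y. e = {x, y}) \<longleftrightarrow> (\<exists>y\<in>Y. \<exists>x\<in>X. e = {y, x})" for e
    by (metis insert_commute)
  then show ?thesis
    unfolding bipartite_parts_def by (simp only: Un_commute[of X Y] Int_commute[of X Y])
qed

text \<open>All edges at \<open>s\<close> lead to the other side, so inside
  \<open>S \<union> T\<close> they correspond to the neighbours of \<open>s\<close> in
  \<open>T\<close>.\<close>

lemma vdegree_induced_bipartite: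
  assumes "bipartite_parts V E X Y" "S \<subseteq> X" "T \<subseteq> Y" "s \<in> S"
  shows "vdegree (induced_edges E (S \<union> T)) s = card {y\<in>T. bip_adj E s y = 1}"
proof -
  have "{e \<in> induced_edges E (S \<union> T). s \<in> e} = (\<lambda>y. {s, y}) ` {y\<in>T. bip_adj E s y = 1}"
  proof (intro equalityI subsetI)
    fix e assume "e \<in> {e \<in> induced_edges E (S \<union> T). s \<in> e}"
    then have e: "e \<in> E" "e \<subseteq> S \<union> T" "s \<in> e" by (auto simp: induced_edges_def)
    then obtain x y where xy: "x \<in> X" "y \<in> Y" "e = {x, y}"
      using assms(1) unfolding bipartite_parts_def by blast
    have "X \<inter> Y = {}" using assms(1) by (simp add: bipartite_parts_def)
    then have "s = x" "y \<in> T" using xy e assms by auto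
    then show "e \<in> (\<lambda>y. {s, y}) ` {y\<in>T. bip_adj E s y = 1}"
      using xy e by (auto simp: bip_adj_def)
  next
    fix e assume "e \<in> (\<lambda>y. {s, y}) ` {y\<in>T. bip_adj E s y = 1}"
    then show "e \<in> {e \<in> induced_edges E (S \<union> T). s \<in> e}"
      using assms(4) by (auto simp: induced_edges_def bip_adj_def split: if_splits)
  qed
  moreover have "inj_on (\<lambda>y. {s, y}) {y\<in>T. bip_adj E s y = 1}"
    by (auto simp: inj_on_def doubleton_eq_iff)
  ultimately show ?thesis by (simp add: vdegree_def card_image)
qed

lemma f_odd_ge:
  assumes "finite V" "W \<subseteq> V" "\<forall>v\<in>W. odd (vdegree (induced_edges E W) v)"
  shows "card W \<le> f_odd V E"
proof -
  have "finite {S. S \<subseteq> V \<and> (\<forall>v\<in>S. odd (vdegree (induced_edges E S) v))}"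
    by (rule finite_subset[of _ "Pow V"]) (use assms(1) in auto)
  then show ?thesis unfolding f_odd_def using assms by (intro Max_ge) auto
qed

text \<open>Reduces the problem to finding a heavy vector in the span of the neighbourhood vectors
  of \<open>Q\<close>: the pair \<open>S\<close>, \<open>T\<close> obtained from its support induces
  a subgraph with all degrees odd.\<close>

lemma f_odd_ge_row_combination_weight:
  assumes "finite V" "bipartite_parts V E Q P" "S0 \<subseteq> Q"
  shows "card {x\<in>P. (\<Sum>q\<in>S0. bip_adj E q x) = 1} \<le> f_odd V E"
proof -
  have VQP: "V = Q \<union> P" "Q \<inter> P = {}" using assms(2) by (auto simp: bipartite_parts_def)
  then have fin: "finite Q" "finite P" using assms(1) by auto
  define T0 where "T0 = {x\<in>P. (\<Sum>q\<in>S0. bip_adj E q x) = 1}"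
  have T0: "T0 \<subseteq> P" "\<forall>x\<in>T0. (\<Sum>q\<in>S0. bip_adj E q x) = 1"
    by (auto simp: T0_def)
  obtain S T where ST: "S \<subseteq> Q" "T \<subseteq> P" "card T0 \<le> card S + card T"
    "\<forall>s\<in>S. (\<Sum>x\<in>T. bip_adj E s x) = 1" "\<forall>x\<in>T. (\<Sum>s\<in>S. bip_adj E s x) = 1"
    using odd_pair_of_row_combination[OF fin(1) T0(1) fin(2) assms(3) T0(2)]
    by (elim exE conjE)
  have finST: "finite S" "finite T" using ST(1,2) fin by (auto intro: finite_subset)
  have "odd (vdegree (induced_edges E (S \<union> T)) v)" if "v \<in> S \<union> T" for v
  proof (cases "v \<in> S")
    case True
    show ?thesis
      using bspec[OF ST(4) True]
      unfolding sum_bit_eq_1_iff[OF finST(2)]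
        vdegree_induced_bipartite[OF assms(2) ST(1,2) True] .
  next
    case False
    then have v: "v \<in> T" using that by auto
    have "(\<Sum>s\<in>S. bip_adj E v s) = 1" using bspec[OF ST(5) v] unfolding bip_adj_commute[of E v] .
    then show ?thesis
      unfolding sum_bit_eq_1_iff[OF finST(1)] Un_commute[of S T]
        vdegree_induced_bipartite[OF iffD1[OF bipartite_parts_commute assms(2)] ST(2,1) v] .
  qed
  moreover have "S \<union> T \<subseteq> V" using ST(1,2) VQP(1) by auto
  ultimately have "card (S \<union> T) \<le> f_odd V E"
    by (intro f_odd_ge[OF assms(1)] ballI)
  moreover have "card (S \<union> T) = card S + card T"
    using finST ST(1,2) VQP by (intro card_Un_disjoint) auto
  ultimately show ?thesis using ST(3) by (simp add: T0_def)
qed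

lemma min_vdegree_neighbour:
  assumes "simple_graph V E" "bipartite_parts V E Q P" "min_vdegree V E \<ge> 1" "x \<in> P"
  obtains q where "q \<in> Q" "bip_adj E x q = 1"
proof -
  have VQP: "V = Q \<union> P" "Q \<inter> P = {}" using assms(2) by (auto simp: bipartite_parts_def)
  have "finite V" using assms(1) by (simp add: simple_graph_def)
  then have "min_vdegree V E \<le> vdegree E x"
    unfolding min_vdegree_def using assms(4) VQP by (intro Min_le) auto
  then have "vdegree E x \<noteq> 0" using assms(3) by linarith
  then obtain e where e: "e \<in> E" "x \<in> e"
    unfolding vdegree_def by (auto simp: card_eq_0_iff)
  then obtain q y where qy: "q \<in> Q" "y \<in> P" "e = {q, y}"
    using assms(2) unfolding bipartite_parts_def by blast
  then have "y = x" using e assms(4) VQP by auto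
  then show thesis using that[of q] qy e by (simp add: bip_adj_def insert_commute)
qed

text \<open>Rows are indexed by \<open>P\<close>, so the pivots are vertices of the side on which
  the weight is counted.\<close>

lemma f_odd_ge_rank_bound:
  assumes G: "simple_graph V E" "bipartite_parts V E Q P" "min_vdegree V E \<ge> 1"
    and k: "k = matrix_rank P Q (bip_adj E)" and "real k \<le> 2 * real (card P) / 3" and "P \<noteq> {}"
  shows "real (f_odd V E) \<ge> real (card P) / 2 + (real k)\<^sup>2 / (8 * (real (card P) - real k))"
proof -
  let ?A = "bip_adj E"
  have finV: "finite V" and VQP: "V = Q \<union> P"
    using G by (auto simp: simple_graph_def bipartite_parts_def)
  then have fin: "finite Q" "finite P" by auto
  then have m: "card P > 0" using assms(6) by (simp add: card_gt_0_iff)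
  obtain C where C: "C \<subseteq> P" "card C = k"
    "\<forall>d. (\<forall>j\<in>Q. (\<Sum>c\<in>C. d c * ?A c j) = 0) \<longrightarrow> (\<forall>c\<in>C. d c = 0)"
    "\<forall>i\<in>P. \<exists>a. \<forall>j\<in>Q. ?A i j = (\<Sum>c\<in>C. a c * ?A c j)"
    unfolding k by (rule pivot_rows[OF fin(2)])
  have finC: "finite C" using C(1) fin finite_subset by blast
  have "\<exists>D\<subseteq>C. (\<forall>j\<in>Q. ?A x j = (\<Sum>c\<in>D. ?A c j)) \<and> (x \<in> C \<longrightarrow> D = {x})" if x: "x \<in> P" for x
  proof (cases "x \<in> C")
    case True
    then show ?thesis by (intro exI[of _ "{x}"]) auto
  next
    case False
    obtain a where "\<forall>j\<in>Q. ?A x j = (\<Sum>c\<in>C. a c * ?A c j)" using bspec[OF C(4) x] by blast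
    then show ?thesis
      using False unfolding sum_bit_mult[OF finC]
      by (intro exI[of _ "{c\<in>C. a c = 1}"] conjI) blast+
  qed
  then obtain D where D': "\<forall>x\<in>P. D x \<subseteq> C \<and> (\<forall>j\<in>Q. ?A x j = (\<Sum>c\<in>D x. ?A c j)) \<and> (x \<in> C \<longrightarrow> D x = {x})"
    by (rule bchoice[OF ballI, THEN exE])
  then have D: "\<And>x. x \<in> P \<Longrightarrow> D x \<subseteq> C"
    "\<And>x j. x \<in> P \<Longrightarrow> j \<in> Q \<Longrightarrow> ?A x j = (\<Sum>c\<in>D x. ?A c j)" "\<And>c. c \<in> C \<Longrightarrow> D c = {c}"
    using C(1) by auto
  \<comment> \<open>An empty \<open>D x\<close> would mean a zero row, that is, an isolated
    vertex.\<close>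
  have Dne: "D x \<noteq> {}" if x: "x \<in> P" for x
  proof
    assume "D x = {}"
    then have "?A x q = 0" if "q \<in> Q" for q using D(2)[OF x that] by (metis sum.empty)
    moreover obtain q where "q \<in> Q" "?A x q = 1" by (rule min_vdegree_neighbour[OF G x])
    ultimately show False by simp
  qed
  \<comment> \<open>The maximiser of \<open>k * t - 2 * (card P - k) * t\<^sup>2\<close>; the
    assumed upper bound on \<open>k\<close> is equivalent to \<open>t \<le> 1/2\<close>.\<close>
  define t where "t = real k / (4 * (real (card P) - real k))"
  have km: "real (card P) - real k > 0" using assms(5) m by simp
  have t: "0 \<le> t" "t \<le> 1/2" using km assms(5) by (auto simp: t_def field_simps)
  obtain U where U: "U \<subseteq> C" "real (card {x\<in>P. odd (card (U \<inter> D x))})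
      \<ge> card P / 2 + k * t - 2 * (real (card P) - k) * t\<^sup>2"
    using exists_subset_many_odd[OF fin(2) C(1) D(1) Dne D(3) t] unfolding C(2) by blast
  have "a * (a / (4 * d)) - 2 * d * (a / (4 * d))\<^sup>2 = a\<^sup>2 / (8 * d)" if "d > 0" for a d :: real
    using that by (simp add: field_simps power2_eq_square)
  from this[OF km, of k]
  have "k * t - 2 * (real (card P) - k) * t\<^sup>2 = (real k)\<^sup>2 / (8 * (real (card P) - real k))"
    by (simp only: t_def)
  then have bound: "real (card {x\<in>P. odd (card (U \<inter> D x))})
      \<ge> card P / 2 + (real k)\<^sup>2 / (8 * (real (card P) - real k))"
    using U(2) by linarith
  \<comment> \<open>Since the pivot rows are independent on \<open>Q\<close>, a subset sum over
    \<open>Q\<close> can take any values on \<open>C\<close>; here it realises the indicator of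
    \<open>U\<close>.\<close>
  have "\<exists>j\<in>Q. (\<Sum>c\<in>B. ?A j c) = 1" if "B \<subseteq> C" "B \<noteq> {}" for B
  proof (rule ccontr)
    assume "\<not> ?thesis"
    then have "\<forall>j\<in>Q. (\<Sum>c\<in>B. ?A c j) = 0" by (simp add: bip_adj_commute)
    moreover have "(\<Sum>c\<in>C. of_bool (c \<in> B) * ?A c j) = (\<Sum>c\<in>B. ?A c j)" for j
      using that(1) finC by (intro sum.mono_neutral_cong_right) auto
    ultimately have "\<forall>j\<in>Q. (\<Sum>c\<in>C. of_bool (c \<in> B) * ?A c j) = 0" by simp
    then have "\<forall>c\<in>C. (of_bool (c \<in> B) :: bit) = 0" by (rule C(3)[THEN spec, THEN mp])
    then show False using that by auto
  qed
  then have "\<exists>S0. S0 \<subseteq> Q \<and> card S0 \<le> card C \<and> (\<forall>c\<in>C. (\<Sum>q\<in>S0. ?A q c) = of_bool (c \<in> U))"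
    by (rule independent_system_solvable_bit[OF finC fin(1)])
  then obtain S0 where S0: "S0 \<subseteq> Q" "\<forall>c\<in>C. (\<Sum>q\<in>S0. ?A q c) = of_bool (c \<in> U)"
    by (elim exE conjE)
  \<comment> \<open>The value at \<open>x\<close> is the sum of the values at the pivots in
    \<open>D x\<close>, hence the parity of \<open>U \<inter> D x\<close>.\<close>
  have "(\<Sum>q\<in>S0. ?A q x) = 1 \<longleftrightarrow> odd (card (U \<inter> D x))" if x: "x \<in> P" for x
  proof -
    have finD: "finite (D x)" using D(1)[OF x] finC finite_subset by blast
    have "(\<Sum>q\<in>S0. ?A q x) = (\<Sum>q\<in>S0. \<Sum>c\<in>D x. ?A q c)"
    proof (rule sum.cong[OF refl])
      fix q assume "q \<in> S0"
      then have "?A x q = (\<Sum>c\<in>D x. ?A c q)" using S0(1) D(2)[OF x] by blast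
      then show "?A q x = (\<Sum>c\<in>D x. ?A q c)" by (simp only: bip_adj_commute[of E q])
    qed
    also have "\<dots> = (\<Sum>c\<in>D x. \<Sum>q\<in>S0. ?A q c)" by (rule sum.swap)
    also have "\<dots> = (\<Sum>c\<in>D x. of_bool (c \<in> U))"
      using D(1)[OF x] S0(2) by (intro sum.cong) auto
    finally show ?thesis
      using sum_bit_eq_1_iff[OF finD, of "\<lambda>c. of_bool (c \<in> U)"]
      by (simp add: Int_def conj_commute)
  qed
  then have "{x\<in>P. (\<Sum>q\<in>S0. ?A q x) = 1} = {x\<in>P. odd (card (U \<inter> D x))}" by auto
  then have "real (card {x\<in>P. odd (card (U \<inter> D x))}) \<le> real (f_odd V E)"
    using f_odd_ge_row_combination_weight[OF finV G(2) S0(1)] by simp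
  then show ?thesis using bound by linarith
qed

theorem lemma18:
  fixes V X Y :: "'a set" and E :: "'a set set" and n k m :: nat
  assumes "simple_graph V E"
    and "n = card V"
    and "bipartite_parts V E X Y"
    and "min_vdegree V E \<ge> 1"
    and "k = matrix_rank X Y (bip_adj E)"
    and "m = max (card X) (card Y)"
    and "real k \<le> 2 * real m / 3"
  shows "real m \<ge> real n / 2
    \<and> real (f_odd V E) \<ge> real m / 2 + (real k)\<^sup>2 / (8 * (real m - real k))"
proof -
  have V: "finite V" "V \<noteq> {}" "V = X \<union> Y" "X \<inter> Y = {}"
    using assms(1,3) by (auto simp: simple_graph_def bipartite_parts_def)
  then have fin: "finite X" "finite Y" by auto
  have n: "n = card X + card Y" using V fin assms(2) by (simp add: card_Un_disjoint)
  have "n > 0" using V assms(2) by (simp add: card_gt_0_iff)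
  then have "m > 0" using n assms(6) by auto
  have "real (f_odd V E) \<ge> real m / 2 + (real k)\<^sup>2 / (8 * (real m - real k))"
  proof (cases "card Y \<le> card X")
    case True
    then have "m = card X" using assms(6) by simp
    then show ?thesis
      using f_odd_ge_rank_bound[of V E Y X k] assms \<open>m > 0\<close> bipartite_parts_commute[of V E X Y]
      by (simp add: card_gt_0_iff)
  next
    case False
    then have "m = card Y" using assms(6) by simp
    \<comment> \<open>The larger side must index the rows. As \<open>bip_adj\<close> is symmetric in
      its vertices, transposing only swaps the index sets.\<close>
    moreover have "(\<lambda>j i. bip_adj E i j) = bip_adj E"
      by (intro ext bip_adj_commute)
    then have "k = matrix_rank Y X (bip_adj E)"
      using matrix_rank_transpose[OF fin, of "bip_adj E"] assms(5) by simp
    ultimately show ?thesis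
      using f_odd_ge_rank_bound[of V E X Y k] assms \<open>m > 0\<close>
      by (simp add: card_gt_0_iff)
  qed
  moreover have "real m \<ge> real n / 2" using n assms(6) by simp
  ultimately show ?thesis by blast
qed

end
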